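(* Assume that for every $i\in\{1,\dots,M\}$: $K_i$ is such that $F_{ii}=A_{ii}+B_{ii}K_i$ is Schur; $Z_i\subset\mathbb{R}^{n_i}$ is a compact convex set containing the origin in its interior with $F_{ii}Z_i\oplus W_i\subseteq Z_i$; and there exist compact convex sets $\hat X_i\subseteq\mathbb{R}^{n_i}$, $\hat U_i\subseteq\mathbb{R}^{m_i}$, each containing the origin in its interior, with $\hat X_i\subseteq X_i\ominus Z_i$ and $\hat U_i\subseteq U_i\ominus K_iZ_i$ (these are the tightened nominal constraint sets of a tube MPC scheme). Then $F=A+BK$ with $K=\mathrm{diag}(K_1,\dots,K_M)$ is Schur.
   Context: A network of $M$ linear time-invariant subsystems, indexed by $i\in\{1,\dots,M\}$, with states $x^i\in\mathbb{R}^{n_i}$ and inputs $u^i\in\mathbb{R}^{m_i}$, evolves as $x^i_{t+1}=A_{ii}x^i_t+B_{ii}u^i_t+\sum_{j\in\mathcal{N}_i}(A_{ij}x^j_t+B_{ij}u^j_t)$, where $\mathcal{N}_i\subseteq\{1,\dots,M\}\setminus\{i\}$ is the set of neighbours of $i$; set $A_{ij}=0$, $B_{ij}=0$ for $j\notin\mathcal{N}_i\cup\{i\}$. The global model is $x_{t+1}=Ax_t+Bu_t$ with $A$, $B$ the block matrices with blocks $A_{ij}$, $B_{ij}$. Local constraint sets $X_i\subset\mathbb{R}^{n_i}$, $U_i\subset\mathbb{R}^{m_i}$ are compact, convex, and contain the origin in their interiors. The disturbance set of subsystem $i$ is $W_i=\bigoplus_{j\in\mathcal{N}_i}(A_{ij}X_j\oplus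 B_{ij}U_j)$ (with $W_i=\{0\}$ if $\mathcal{N}_i=\emptyset$). Notation: $\mathcal{A}\oplus\mathcal{B}=\{a+b:a\in\mathcal{A},b\in\mathcal{B}\}$ (Minkowski sum), $\mathcal{A}\ominus\mathcal{B}=\{a:a+b\in\mathcal{A}\ \forall b\in\mathcal{B}\}$ (Pontryagin difference), $MS=\{Ms:s\in S\}$. A square matrix is Schur if its spectral radius is $<1$. *)

theory Defs
  imports "HOL-Analysis.Analysis"
begin

text \<open>Global coordinates: state coordinates of type 'n, input coordinates of type 'p.
  The map sx (resp. su) assigns each state (resp. input) coordinate to the subsystem
  owning it; the local space R^{n_i} is identified with the coordinate subspace
  of the global space supported on the coordinates of subsystem i.\<close>

definition loc_space :: "('c \<Rightarrow> 'm) \<Rightarrow> 'm \<Rightarrow> (real^'c) set" where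
  "loc_space s i = {x. \<forall>r. s r \<noteq> i \<longrightarrow> x $ r = 0}"

text \<open>Block (i,j) of a matrix whose rows are partitioned by sr and columns by sc,
  embedded in the global matrix (zeros outside the block).\<close>
definition blk :: "('r \<Rightarrow> 'm) \<Rightarrow> ('c \<Rightarrow> 'm) \<Rightarrow> 'm \<Rightarrow> 'm \<Rightarrow> real^'c^'r \<Rightarrow> real^'c^'r" where
  "blk sr sc i j M = (\<chi> r c. if sr r = i \<and> sc c = j then M $ r $ c else 0)"

definition cmat :: "real^'c^'r \<Rightarrow> complex^'c^'r" where
  "cmat A = (\<chi> r c. complex_of_real (A $ r $ c))"

text \<open>Schur: spectral radius < 1, i.e. every (complex) eigenvalue has modulus < 1.\<close>
definition schur :: "real^'n^'n \<Rightarrow> bool" where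
  "schur A \<longleftrightarrow> (\<forall>(lam::complex) v. v \<noteq> 0 \<and> cmat A *v v = lam *s v \<longrightarrow> cmod lam < 1)"

text \<open>Compact convex subset of the local space containing the origin in its interior
  (interior taken in the local space R^{n_i}).\<close>
definition local_C_set :: "('c \<Rightarrow> 'm) \<Rightarrow> 'm \<Rightarrow> (real^'c) set \<Rightarrow> bool" where
  "local_C_set s i S \<longleftrightarrow> S \<subseteq> loc_space s i \<and> compact S \<and> convex S \<and>
     (\<exists>e>0. cball 0 e \<inter> loc_space s i \<subseteq> S)"

definition msum :: "('a::plus) set \<Rightarrow> 'a set \<Rightarrow> 'a set" where
  "msum P Q = {a + b | a b. a \<in> P \<and> b \<in> Q}"

definition pdiff :: "('a::plus) set \<Rightarrow> 'a set \<Rightarrow> 'a set" where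
  "pdiff P Q = {a. \<forall>b\<in>Q. a + b \<in> P}"

text \<open>Disturbance set W_i = (Minkowski sum over j in N_i) (A_ij X_j + B_ij U_j);
  equals {0} if N_i is empty.\<close>
definition wset :: "real^'n^'n \<Rightarrow> real^'p^'n \<Rightarrow> ('n \<Rightarrow> 'm) \<Rightarrow> ('p \<Rightarrow> 'm)
    \<Rightarrow> ('m \<Rightarrow> 'm set) \<Rightarrow> ('m \<Rightarrow> (real^'n) set) \<Rightarrow> ('m \<Rightarrow> (real^'p) set) \<Rightarrow> 'm \<Rightarrow> (real^'n) set" where
  "wset A B sx su N X U i =
     {(\<Sum>j\<in>N i. blk sx sx i j A *v x j + blk sx su i j B *v u j) | x u.
        \<forall>j\<in>N i. x j \<in> X j \<and> u j \<in> U j}"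

end

theory Submission
  imports Defs "Jordan_Normal_Form.Spectral_Radius"
begin

text \<open>Split the closed loop \<open>F = A + B K\<close> as \<open>F = D + C\<close>, where \<open>D\<close> is the
  block-diagonal part \<open>diag (F\<^sub>i\<^sub>i)\<close> and \<open>C\<close> the coupling between neighbours.
  Since the tightened sets contain neighbourhoods of the origin, for some \<open>d > 0\<close> the
  inflated sets \<open>(1 + d) Z\<^sub>j\<close> and \<open>(1 + d) K\<^sub>j Z\<^sub>j\<close> still lie in \<open>X\<^sub>j\<close> and \<open>U\<^sub>j\<close>,
  so the invariance \<open>F\<^sub>i\<^sub>i Z\<^sub>i \<oplus> W\<^sub>i \<subseteq> Z\<^sub>i\<close> shows that both \<open>D\<close> and
  \<open>G = D + (1 + d) C\<close> map the product \<open>Z\<close> of the \<open>Z\<^sub>i\<close> into itself.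
  As \<open>F = a D + (1 - a) G\<close> with \<open>a = d / (1 + d)\<close>, convexity gives
  \<open>F\<^sup>N Z \<subseteq> a\<^sup>N D\<^sup>N Z + (1 - a\<^sup>N) Z\<close>, and as every \<open>F\<^sub>i\<^sub>i\<close> is Schur,
  \<open>2 D\<^sup>N Z \<subseteq> Z\<close> for large \<open>N\<close>. Hence \<open>F\<^sup>N Z \<subseteq> (1 - a\<^sup>N / 2) Z\<close>; since \<open>Z\<close> is
  bounded and absorbing, every orbit of \<open>F\<close> decays geometrically, which rules out
  eigenvalues of modulus at least 1.\<close>

no_notation Matrix.vec_index (infixl "$" 100)

section \<open>Matrix powers and the spectral radius\<close>

primrec matpow :: "'a::semiring_1^'n^'n \<Rightarrow> nat \<Rightarrow> 'a^'n^'n" where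
  "matpow M 0 = Finite_Cartesian_Product.mat 1"
| "matpow M (Suc k) = matpow M k ** M"

lemma matpow_commute: "M ** matpow M k = matpow M k ** M"
  by (induction k) (simp_all add: matrix_mul_assoc)

lemma funpow_matrix_vector_mult: "(((*v) M) ^^ k) y = matpow M k *v y"
  by (induction k) (simp_all, metis matrix_vector_mul_assoc matpow_commute)

lemma funpow_matrix_vector_mult_scaleR:
  "(((*v) (M::real^'n^'n)) ^^ k) (c *\<^sub>R x) = c *\<^sub>R (((*v) M) ^^ k) x"
  by (simp add: funpow_matrix_vector_mult matrix_vector_mult_scaleR)

lemma funpow_eigenvector:
  fixes M :: "'a::field^'n^'n"
  assumes "M *v v = c *s v"
  shows "(((*v) M) ^^ k) v = c ^ k *s v"
  by (induction k) (simp_all add: assms vector_scalar_commute vector_smult_assoc mult.commute)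

text \<open>Matrices over a finite index type are transferred to the Jordan normal form
  library through a fixed enumeration of the index type.\<close>

definition enum_index :: "'n::finite \<Rightarrow> nat" where
  "enum_index = (SOME f. bij_betw f (UNIV::'n set) {..<CARD('n)})"

definition enum_elem :: "nat \<Rightarrow> 'n::finite" where
  "enum_elem = inv_into UNIV enum_index"

lemma bij_enum_index: "bij_betw (enum_index::'n::finite \<Rightarrow> nat) UNIV {..<CARD('n)}"
proof -
  have "\<exists>f. bij_betw f (UNIV::'n set) {..<CARD('n)}"
    using ex_bij_betw_finite_nat[of "UNIV::'n set"] by (simp add: atLeast0LessThan)
  thus ?thesis unfolding enum_index_def by (rule someI_ex)
qed

lemma bij_enum_elem: "bij_betw (enum_elem::nat \<Rightarrow> 'n::finite) {..<CARD('n)} UNIV"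
  unfolding enum_elem_def by (rule bij_betw_inv_into[OF bij_enum_index])

lemma enum_index_less [simp]: "enum_index (c::'n::finite) < CARD('n)"
  using bij_enum_index unfolding bij_betw_def by auto

lemma enum_elem_index [simp]: "enum_elem (enum_index (c::'n::finite)) = c"
  unfolding enum_elem_def using bij_enum_index[where 'n='n]
  by (simp add: bij_betw_def inv_into_f_f)

lemma enum_index_elem [simp]: "i < CARD('n::finite) \<Longrightarrow> enum_index (enum_elem i :: 'n) = i"
  unfolding enum_elem_def using bij_enum_index[where 'n='n]
  by (simp add: bij_betw_def f_inv_into_f)

lemma sum_enum_elem: "(\<Sum>k = 0..<CARD('n::finite). g (enum_elem k :: 'n)) = (\<Sum>c\<in>UNIV. g c)"
  using sum.reindex_bij_betw[OF bij_enum_elem, of g] by (simp add: atLeast0LessThan)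

definition mat_of_cart :: "'a^'n::finite^'n \<Rightarrow> 'a Matrix.mat" where
  "mat_of_cart X = Matrix.mat CARD('n) CARD('n) (\<lambda>(i,j). X $ enum_elem i $ enum_elem j)"

definition cart_of_vec :: "'a Matrix.vec \<Rightarrow> 'a^'n::finite" where
  "cart_of_vec w = (\<chi> c. vec_index w (enum_index c))"

lemma mat_of_cart_carrier [simp]:
  "mat_of_cart (X::'a^'n::finite^'n) \<in> carrier_mat CARD('n) CARD('n)"
  unfolding mat_of_cart_def by simp

lemma mat_of_cart_dim [simp]:
  "dim_row (mat_of_cart (X::'a^'n::finite^'n)) = CARD('n)"
  "dim_col (mat_of_cart (X::'a^'n::finite^'n)) = CARD('n)"
  unfolding mat_of_cart_def by simp_all

lemma mat_of_cart_index:
  "i < CARD('n) \<Longrightarrow> j < CARD('n) \<Longrightarrow>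
    mat_of_cart (X::'a^'n::finite^'n) $$ (i,j) = X $ enum_elem i $ enum_elem j"
  unfolding mat_of_cart_def by simp

lemma mat_of_cart_mult:
  "mat_of_cart ((X::'a::semiring_1^'n::finite^'n) ** Y) = mat_of_cart X * mat_of_cart Y"
  by (rule eq_matI)
    (auto simp: mat_of_cart_index scalar_prod_def matrix_matrix_mult_def index_row
      intro: sum_enum_elem[symmetric])

lemma mat_of_cart_one:
  "mat_of_cart (Finite_Cartesian_Product.mat 1 :: 'a::semiring_1^'n::finite^'n) = 1\<^sub>m CARD('n)"
  by (rule eq_matI) (auto simp: mat_of_cart_index Finite_Cartesian_Product.mat_def, metis enum_index_elem)

lemma mat_of_cart_matpow: "mat_of_cart (matpow X k) = mat_of_cart X ^\<^sub>m k"
  by (induction k) (simp_all add: mat_of_cart_one mat_of_cart_mult)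

lemma mat_of_cart_mult_vec:
  assumes "w \<in> carrier_vec CARD('n)"
  shows "vec_index (mat_of_cart (X::'a::semiring_1^'n::finite^'n) *\<^sub>v w) (enum_index c)
    = (X *v cart_of_vec w) $ c"
proof -
  have "vec_index (mat_of_cart X *\<^sub>v w) (enum_index c)
      = (\<Sum>k = 0..<CARD('n). X $ c $ enum_elem k * vec_index w k)"
    using assms by (simp add: mat_of_cart_index scalar_prod_def index_row)
  also have "\<dots> = (\<Sum>k = 0..<CARD('n). X $ c $ enum_elem k * vec_index w (enum_index (enum_elem k :: 'n)))"
    by (rule sum.cong) auto
  also have "\<dots> = (\<Sum>d\<in>UNIV. X $ c $ d * vec_index w (enum_index d))"
    by (rule sum_enum_elem)
  finally show ?thesis by (simp add: matrix_vector_mult_def cart_of_vec_def)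
qed

lemma eigenvector_mat_of_cart:
  fixes X :: "'a::comm_ring_1^'n::finite^'n"
  assumes "eigenvector (mat_of_cart X) w c"
  shows "(cart_of_vec w :: 'a^'n) \<noteq> 0" and "X *v cart_of_vec w = c *s cart_of_vec w"
proof -
  have w: "w \<in> carrier_vec CARD('n)" "w \<noteq> 0\<^sub>v CARD('n)" "mat_of_cart X *\<^sub>v w = c \<cdot>\<^sub>v w"
    using assms unfolding eigenvector_def by auto
  show "X *v cart_of_vec w = c *s cart_of_vec w"
    using mat_of_cart_mult_vec[OF w(1), of X] w
    by (simp add: Finite_Cartesian_Product.vec_eq_iff cart_of_vec_def)
  show "(cart_of_vec w :: 'a^'n) \<noteq> 0"
  proof
    assume "cart_of_vec w = (0::'a^'n)"
    hence "vec_index w i = 0" if "i < CARD('n)" for i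
      using that by (metis cart_of_vec_def enum_index_elem vec_lambda_beta zero_index)
    hence "w = 0\<^sub>v CARD('n)" using w(1) by (intro eq_vecI) auto
    with w(2) show False ..
  qed
qed

lemma cmat_mult: "cmat ((X::real^'k::finite^'n) ** (Y::real^'m^'k)) = cmat X ** cmat Y"
  by (simp add: cmat_def matrix_matrix_mult_def Finite_Cartesian_Product.vec_eq_iff)

lemma cmat_one:
  "cmat (Finite_Cartesian_Product.mat 1 :: real^'n::finite^'n) = Finite_Cartesian_Product.mat 1"
  by (simp add: cmat_def Finite_Cartesian_Product.mat_def Finite_Cartesian_Product.vec_eq_iff)

lemma cmat_matpow: "cmat (matpow (X::real^'n::finite^'n) k) = matpow (cmat X) k"
  by (induction k) (simp_all add: cmat_one cmat_mult)

lemma spectral_radius_less_1_if_schur: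
  fixes M :: "real^'n::finite^'n"
  assumes "schur M"
  shows "spectral_radius (mat_of_cart (cmat M)) < 1"
proof -
  obtain c where c: "c \<in> spectrum (mat_of_cart (cmat M))"
    "spectral_radius (mat_of_cart (cmat M)) = cmod c"
    using spectral_radius_mem_max(1)[OF mat_of_cart_carrier zero_less_card_finite] by force
  then obtain w where "eigenvector (mat_of_cart (cmat M)) w c"
    unfolding spectrum_def eigenvalue_def by auto
  with assms c(2) show ?thesis
    unfolding schur_def using eigenvector_mat_of_cart by metis
qed

lemma pow_smult_mat:
  assumes "A \<in> carrier_mat n n"
  shows "((c::'a::comm_ring_1) \<cdot>\<^sub>m A) ^\<^sub>m k = (c ^ k) \<cdot>\<^sub>m (A ^\<^sub>m k)"
proof (induction k)
  case 0 show ?case by (rule eq_matI) auto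
next
  case (Suc k)
  have "(c \<cdot>\<^sub>m A) ^\<^sub>m Suc k = c ^ k \<cdot>\<^sub>m (A ^\<^sub>m k * (c \<cdot>\<^sub>m A))"
    using Suc assms by (simp add: mult_smult_assoc_mat[where nr=n and n=n and nc=n])
  also have "\<dots> = (c ^ Suc k) \<cdot>\<^sub>m (A ^\<^sub>m Suc k)"
    using assms by (subst mult_smult_distrib[where nr=n and n=n and nc=n]) (auto intro!: eq_matI)
  finally show ?case .
qed

lemma spectral_radius_less_1_geometric_bound:
  fixes A :: "complex mat"
  assumes A: "A \<in> carrier_mat n n" and n: "0 < n" and sr: "spectral_radius A < 1"
  shows "\<exists>c r. 0 < r \<and> r < 1 \<and> (\<forall>k. norm_bound (A ^\<^sub>m k) (c * r ^ k))"
proof -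
  have sr0: "0 \<le> spectral_radius A"
    using spectral_radius_mem_max(1)[OF A n] by auto
  define r where "r = (1 + spectral_radius A) / 2"
  have r: "0 < r" "r < 1" "spectral_radius A < r" using sr0 sr by (auto simp: r_def)
  \<comment> \<open>the powers of \<open>A / r\<close> are bounded, so those of \<open>A\<close> decay like \<open>r ^ k\<close>\<close>
  define A' where "A' = complex_of_real (1 / r) \<cdot>\<^sub>m A"
  have A': "A' \<in> carrier_mat n n" using A by (simp add: A'_def)
  have "spectral_radius A' < 1"
  proof -
    obtain c where c: "c \<in> spectrum A'" "spectral_radius A' = cmod c"
      using spectral_radius_mem_max(1)[OF A' n] by force
    then obtain w where w: "w \<in> carrier_vec n" "w \<noteq> 0\<^sub>v n" "A' *\<^sub>v w = c \<cdot>\<^sub>v w"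
      using A' unfolding spectrum_def eigenvalue_def eigenvector_def by auto
    have "A *\<^sub>v w = complex_of_real r \<cdot>\<^sub>v (A' *\<^sub>v w)"
      using A w(1) r(1) by (intro eq_vecI) (auto simp: A'_def scalar_prod_def sum_distrib_left)
    hence "eigenvector A w (complex_of_real r * c)"
      using w A unfolding eigenvector_def by (simp add: smult_smult_assoc)
    hence "cmod (complex_of_real r * c) \<le> spectral_radius A"
      using spectral_radius_mem_max(2)[OF A n] unfolding spectrum_def eigenvalue_def by blast
    hence "r * cmod c \<le> spectral_radius A" using r(1) by (simp add: norm_mult)
    hence "cmod c < 1" using r(3) mult_less_cancel_left_pos[OF r(1), of "cmod c" 1] by linarith
    with c(2) show ?thesis by simp
  qed
  then obtain c where c: "\<And>k. norm_bound (A' ^\<^sub>m k) c"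
    using spectral_radius_jnf_norm_bound_less_1_upper_triangular[OF A'] by auto
  have "norm_bound (A ^\<^sub>m k) (c * r ^ k)" for k
    unfolding norm_bound_def
  proof (intro allI impI)
    fix i j assume ij: "i < dim_row (A ^\<^sub>m k)" "j < dim_col (A ^\<^sub>m k)"
    have "(A' ^\<^sub>m k) $$ (i, j) = complex_of_real ((1 / r) ^ k) * (A ^\<^sub>m k) $$ (i, j)"
      using ij A by (simp add: A'_def pow_smult_mat)
    moreover have "norm ((A' ^\<^sub>m k) $$ (i, j)) \<le> c"
      using c[of k] ij pow_carrier_mat[OF A] pow_carrier_mat[OF A'] unfolding norm_bound_def
      by (metis carrier_matD)
    ultimately have "(1 / r) ^ k * norm ((A ^\<^sub>m k) $$ (i, j)) \<le> c"
      using r(1) by (simp add: norm_mult norm_power norm_divide)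
    thus "norm ((A ^\<^sub>m k) $$ (i, j)) \<le> c * r ^ k"
      using r(1) by (simp add: field_simps)
  qed
  with r show ?thesis by blast
qed

lemma norm_matrix_vector_mult_le:
  "norm ((M::real^'c^'r) *v y) \<le> (\<Sum>a\<in>UNIV. \<Sum>b\<in>UNIV. \<bar>M $ a $ b\<bar>) * norm y"
proof -
  have "norm (M *v y) \<le> (\<Sum>a\<in>UNIV. \<bar>(M *v y) $ a\<bar>)" by (rule norm_le_l1_cart)
  also have "\<dots> \<le> (\<Sum>a\<in>UNIV. \<Sum>b\<in>UNIV. \<bar>M $ a $ b\<bar> * norm y)"
  proof (rule sum_mono)
    fix a
    have "\<bar>(M *v y) $ a\<bar> \<le> (\<Sum>b\<in>UNIV. \<bar>M $ a $ b * y $ b\<bar>)"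
      unfolding matrix_vector_mult_def by (simp add: sum_abs)
    also have "\<dots> \<le> (\<Sum>b\<in>UNIV. \<bar>M $ a $ b\<bar> * norm y)"
      by (rule sum_mono) (simp add: abs_mult mult_left_mono component_le_norm_cart)
    finally show "\<bar>(M *v y) $ a\<bar> \<le> (\<Sum>b\<in>UNIV. \<bar>M $ a $ b\<bar> * norm y)" .
  qed
  also have "\<dots> = (\<Sum>a\<in>UNIV. \<Sum>b\<in>UNIV. \<bar>M $ a $ b\<bar>) * norm y"
    by (simp add: sum_distrib_right)
  finally show ?thesis .
qed

lemma schur_powers_decay:
  fixes M :: "real^'n::finite^'n"
  assumes "schur M"
  shows "\<exists>C r. 0 < r \<and> r < 1 \<and> (\<forall>k y. norm ((((*v) M) ^^ k) y) \<le> C * r ^ k * norm y)"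
proof -
  let ?T = "mat_of_cart (cmat M)"
  obtain c r where r: "0 < r" "r < 1" and c: "\<And>k. norm_bound (?T ^\<^sub>m k) (c * r ^ k)"
    using spectral_radius_less_1_geometric_bound[OF mat_of_cart_carrier zero_less_card_finite
        spectral_radius_less_1_if_schur[OF assms]] by blast
  have entry: "\<bar>matpow M k $ a $ b\<bar> \<le> c * r ^ k" for k a b
  proof -
    have "(?T ^\<^sub>m k) $$ (enum_index a, enum_index b) = complex_of_real (matpow M k $ a $ b)"
      unfolding mat_of_cart_matpow[symmetric] cmat_matpow[symmetric]
      by (simp add: mat_of_cart_index cmat_def)
    moreover have "?T ^\<^sub>m k \<in> carrier_mat CARD('n) CARD('n)" by simp
    ultimately show ?thesis using c[of k] unfolding norm_bound_def
      by (metis carrier_matD enum_index_less norm_of_real)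
  qed
  have "norm ((((*v) M) ^^ k) y) \<le> (CARD('n) * CARD('n) * c) * r ^ k * norm y" for k y
  proof -
    have "norm ((((*v) M) ^^ k) y) \<le> (\<Sum>a\<in>UNIV. \<Sum>b\<in>UNIV. \<bar>matpow M k $ a $ b\<bar>) * norm y"
      unfolding funpow_matrix_vector_mult by (rule norm_matrix_vector_mult_le)
    also have "\<dots> \<le> (\<Sum>a\<in>(UNIV::'n set). \<Sum>b\<in>(UNIV::'n set). c * r ^ k) * norm y"
      by (intro mult_right_mono sum_mono entry) simp
    finally show ?thesis by (simp add: mult.assoc)
  qed
  with r show ?thesis by blast
qed

section \<open>Schur stability from a contracting set\<close>

lemma cmat_mult_vec_Re_Im:
  "cmat (M::real^'c^'r) *v (\<chi> c. complex_of_real (a $ c) + \<i> * complex_of_real (b $ c))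
    = (\<chi> r. complex_of_real ((M *v a) $ r) + \<i> * complex_of_real ((M *v b) $ r))"
  by (simp add: Finite_Cartesian_Product.vec_eq_iff cmat_def matrix_vector_mult_def
      sum.distrib sum_distrib_left algebra_simps)

lemma funpow_cmat_mult_vec:
  fixes M :: "real^'n^'n" and v :: "complex^'n"
  shows "(((*v) (cmat M)) ^^ k) v =
    (\<chi> c. complex_of_real ((((*v) M) ^^ k) (\<chi> d. Re (v $ d)) $ c)
        + \<i> * complex_of_real ((((*v) M) ^^ k) (\<chi> d. Im (v $ d)) $ c))"
proof (induction k)
  case 0 show ?case by (simp add: Finite_Cartesian_Product.vec_eq_iff complex_eq)
next
  case (Suc k) show ?case by (simp add: Suc cmat_mult_vec_Re_Im)
qed

text \<open>A complex eigenvalue of modulus at least 1 would keep the real or the imaginary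
  part of its eigenvector from decaying.\<close>

lemma schur_if_orbits_decay:
  fixes M :: "real^'n^'n"
  assumes \<rho>: "\<bar>\<rho>\<bar> < 1"
    and decay: "\<And>x. \<exists>C. \<forall>m. norm ((((*v) M) ^^ (N * m)) x) \<le> C * \<rho> ^ m"
  shows "schur M"
  unfolding schur_def
proof (intro allI impI)
  fix c :: complex and v :: "complex^'n"
  assume v: "v \<noteq> 0 \<and> cmat M *v v = c *s v"
  show "cmod c < 1"
  proof (rule ccontr)
    assume "\<not> cmod c < 1"
    hence c: "1 \<le> cmod c" by simp
    obtain d where d: "v $ d \<noteq> 0"
      using v by (auto simp: Finite_Cartesian_Product.vec_eq_iff)
    obtain Ca where Ca: "\<And>m. norm ((((*v) M) ^^ (N * m)) (\<chi> d. Re (v $ d))) \<le> Ca * \<rho> ^ m"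
      using decay by blast
    obtain Cb where Cb: "\<And>m. norm ((((*v) M) ^^ (N * m)) (\<chi> d. Im (v $ d))) \<le> Cb * \<rho> ^ m"
      using decay by blast
    have "cmod (v $ d) \<le> (Ca + Cb) * \<rho> ^ m" for m
    proof -
      let ?a = "(((*v) M) ^^ (N * m)) (\<chi> d. Re (v $ d))"
      let ?b = "(((*v) M) ^^ (N * m)) (\<chi> d. Im (v $ d))"
      have "(((*v) (cmat M)) ^^ (N * m)) v $ d = c ^ (N * m) * v $ d"
        using funpow_eigenvector[where M="cmat M" and v=v and c=c and k="N * m"] v by simp
      hence eigen: "c ^ (N * m) * v $ d = complex_of_real (?a $ d) + \<i> * complex_of_real (?b $ d)"
        unfolding funpow_cmat_mult_vec by simp
      have "cmod (v $ d) \<le> cmod c ^ (N * m) * cmod (v $ d)"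
        using one_le_power[OF c] by (simp add: mult_le_cancel_right1)
      also have "\<dots> = cmod (complex_of_real (?a $ d) + \<i> * complex_of_real (?b $ d))"
        by (simp flip: eigen add: norm_mult norm_power)
      also have "\<dots> \<le> \<bar>?a $ d\<bar> + \<bar>?b $ d\<bar>"
        using cmod_le[of "complex_of_real (?a $ d) + \<i> * complex_of_real (?b $ d)"] by simp
      also have "\<dots> \<le> Ca * \<rho> ^ m + Cb * \<rho> ^ m"
        using Ca[of m] Cb[of m] component_le_norm_cart[of ?a d] component_le_norm_cart[of ?b d]
        by linarith
      finally show ?thesis by (simp add: distrib_right)
    qed
    moreover have "(\<lambda>m. (Ca + Cb) * \<rho> ^ m) \<longlonglongrightarrow> 0"
      using \<rho> by (intro tendsto_mult_right_zero LIMSEQ_power_zero) simp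
    ultimately have "cmod (v $ d) \<le> 0"
      by (intro LIMSEQ_le_const[of "\<lambda>m. (Ca + Cb) * \<rho> ^ m"]) auto
    with d show False by simp
  qed
qed

lemma schur_if_contracts_absorbing_set:
  fixes M :: "real^'n^'n"
  assumes "bounded S" and absorbing: "\<And>x. \<exists>t>0. t *\<^sub>R x \<in> S"
    and \<rho>: "0 \<le> \<rho>" "\<rho> < 1"
    and contracts: "\<And>x. x \<in> S \<Longrightarrow> \<exists>y\<in>S. (((*v) M) ^^ N) x = \<rho> *\<^sub>R y"
  shows "schur M"
proof (rule schur_if_orbits_decay)
  show "\<bar>\<rho>\<bar> < 1" using \<rho> by simp
  have orbit: "\<exists>y\<in>S. (((*v) M) ^^ (N * m)) x = \<rho> ^ m *\<^sub>R y" if "x \<in> S" for x m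
  proof (induction m)
    case 0 show ?case using that by auto
  next
    case (Suc m)
    then obtain y where y: "y \<in> S" "(((*v) M) ^^ (N * m)) x = \<rho> ^ m *\<^sub>R y" by blast
    then obtain y' where y': "y' \<in> S" "(((*v) M) ^^ N) y = \<rho> *\<^sub>R y'" using contracts by blast
    have "(((*v) M) ^^ (N * Suc m)) x = (((*v) M) ^^ N) ((((*v) M) ^^ (N * m)) x)"
      by (simp add: funpow_add)
    also have "\<dots> = \<rho> ^ Suc m *\<^sub>R y'"
      using y y' by (simp add: funpow_matrix_vector_mult_scaleR)
    finally show ?case using y' by blast
  qed
  obtain R where R: "\<And>y. y \<in> S \<Longrightarrow> norm y \<le> R" using \<open>bounded S\<close> by (auto simp: bounded_iff)
  fix x
  obtain t where t: "0 < t" "t *\<^sub>R x \<in> S" using absorbing by blast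
  have "norm ((((*v) M) ^^ (N * m)) x) \<le> R / t * \<rho> ^ m" for m
  proof -
    obtain y where y: "y \<in> S" "(((*v) M) ^^ (N * m)) (t *\<^sub>R x) = \<rho> ^ m *\<^sub>R y"
      using orbit[OF t(2)] by blast
    have "t * norm ((((*v) M) ^^ (N * m)) x) = \<rho> ^ m * norm y"
      using arg_cong[OF y(2), of norm] t(1) \<rho>(1) by (simp add: funpow_matrix_vector_mult_scaleR)
    also have "\<dots> \<le> \<rho> ^ m * R" using R[OF y(1)] \<rho>(1) by (simp add: mult_left_mono)
    finally show ?thesis using t(1) by (simp add: field_simps)
  qed
  thus "\<exists>C. \<forall>m. norm ((((*v) M) ^^ (N * m)) x) \<le> C * \<rho> ^ m" by blast
qed

section \<open>Powers of a convex combination of maps\<close>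

lemma convex_scaled_combination:
  assumes "convex S" "0 \<in> S" "u \<in> S" "v \<in> S" "0 \<le> a" "0 \<le> b"
  shows "\<exists>y\<in>S. a *\<^sub>R u + b *\<^sub>R v = (a + b) *\<^sub>R y"
proof (cases "a + b = 0")
  case True
  hence "a = 0" "b = 0" using assms(5,6) by linarith+
  with assms(2) show ?thesis by (intro bexI[of _ 0]) auto
next
  case False
  hence ab: "0 < a + b" using assms by linarith
  have "(a / (a + b)) *\<^sub>R u + (b / (a + b)) *\<^sub>R v \<in> S"
    using assms ab by (intro convexD) (auto simp: add_divide_distrib[symmetric])
  moreover have "a *\<^sub>R u + b *\<^sub>R v = (a + b) *\<^sub>R ((a / (a + b)) *\<^sub>R u + (b / (a + b)) *\<^sub>R v)"
    using ab by (simp add: scaleR_add_right)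
  ultimately show ?thesis by blast
qed

lemma funpow_convex_split:
  fixes D G F :: "'a::real_vector \<Rightarrow> 'a"
  assumes S: "convex S" "0 \<in> S" and D: "linear D" "D ` S \<subseteq> S" and G: "G ` S \<subseteq> S"
    and a: "0 \<le> a" "a \<le> 1" and F: "\<And>x. F x = a *\<^sub>R D x + (1 - a) *\<^sub>R G x"
    and x: "x \<in> S"
  shows "\<exists>y\<in>S. (F ^^ n) x = a ^ n *\<^sub>R (D ^^ n) x + (1 - a ^ n) *\<^sub>R y"
proof (induction n)
  case 0 show ?case using x by auto
next
  case (Suc n)
  then obtain y where y: "y \<in> S" "(F ^^ n) x = a ^ n *\<^sub>R (D ^^ n) x + (1 - a ^ n) *\<^sub>R y"
    by blast
  have an: "0 \<le> a ^ n" "a ^ n \<le> 1" using a by (auto simp: power_le_one)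
  have Dn: "(D ^^ n) x \<in> S" using x D(2) by (induction n) auto
  let ?w = "(F ^^ n) x"
  have "?w \<in> S" using y(2) convexD[OF S(1) Dn y(1), of "a ^ n" "1 - a ^ n"] an by simp
  hence "G ?w \<in> S" "D y \<in> S" using G D(2) y(1) by auto
  then obtain y' where y': "y' \<in> S"
    "(a * (1 - a ^ n)) *\<^sub>R D y + (1 - a) *\<^sub>R G ?w = (a * (1 - a ^ n) + (1 - a)) *\<^sub>R y'"
    using convex_scaled_combination[OF S, of "D y" "G ?w" "a * (1 - a ^ n)" "1 - a"] an a
    by auto
  have "(F ^^ Suc n) x = a *\<^sub>R D ?w + (1 - a) *\<^sub>R G ?w" by (simp add: F)
  also have "D ?w = a ^ n *\<^sub>R (D ^^ Suc n) x + (1 - a ^ n) *\<^sub>R D y"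
    using y(2) by (simp add: linear_add[OF D(1)] linear_scale[OF D(1)])
  also have "a *\<^sub>R (a ^ n *\<^sub>R (D ^^ Suc n) x + (1 - a ^ n) *\<^sub>R D y) + (1 - a) *\<^sub>R G ?w
      = a ^ Suc n *\<^sub>R (D ^^ Suc n) x + ((a * (1 - a ^ n)) *\<^sub>R D y + (1 - a) *\<^sub>R G ?w)"
    by (simp add: scaleR_add_right)
  also have "\<dots> = a ^ Suc n *\<^sub>R (D ^^ Suc n) x + (1 - a ^ Suc n) *\<^sub>R y'"
    unfolding y'(2) by (simp add: algebra_simps)
  finally show ?case using y'(1) by blast
qed

lemma funpow_contracts_if_convex_split:
  fixes D G F :: "'a::real_vector \<Rightarrow> 'a"
  assumes S: "convex S" "0 \<in> S" and D: "linear D" "D ` S \<subseteq> S" and G: "G ` S \<subseteq> S"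
    and a: "0 < a" "a \<le> 1" and F: "\<And>x. F x = a *\<^sub>R D x + (1 - a) *\<^sub>R G x"
    and half: "\<And>x. x \<in> S \<Longrightarrow> 2 *\<^sub>R (D ^^ N) x \<in> S"
  shows "\<exists>\<rho>. 0 \<le> \<rho> \<and> \<rho> < 1 \<and> (\<forall>x\<in>S. \<exists>y\<in>S. (F ^^ N) x = \<rho> *\<^sub>R y)"
proof (intro exI conjI ballI)
  have aN: "0 < a ^ N" "a ^ N \<le> 1" using a by (auto simp: power_le_one)
  show "0 \<le> 1 - a ^ N / 2" "1 - a ^ N / 2 < 1" using aN by auto
  fix x assume x: "x \<in> S"
  obtain y where y: "y \<in> S" "(F ^^ N) x = a ^ N *\<^sub>R (D ^^ N) x + (1 - a ^ N) *\<^sub>R y"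
    using funpow_convex_split[OF S D G _ _ F x, of N] a by auto
  obtain y' where "y' \<in> S"
    "(a ^ N / 2) *\<^sub>R (2 *\<^sub>R (D ^^ N) x) + (1 - a ^ N) *\<^sub>R y = (a ^ N / 2 + (1 - a ^ N)) *\<^sub>R y'"
    using convex_scaled_combination[OF S half[OF x] y(1), of "a ^ N / 2" "1 - a ^ N"] aN by auto
  with y(2) show "\<exists>y\<in>S. (F ^^ N) x = (1 - a ^ N / 2) *\<^sub>R y" by auto
qed

section \<open>Coordinate blocks\<close>

definition loc_proj :: "('c \<Rightarrow> 'm) \<Rightarrow> 'm \<Rightarrow> real^'c \<Rightarrow> real^'c" where
  "loc_proj s i x = (\<chi> r. if s r = i then x $ r else 0)"

lemma loc_proj_nth: "loc_proj s i x $ r = (if s r = i then x $ r else 0)"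
  by (simp add: loc_proj_def)

lemma loc_proj_add: "loc_proj s i (x + y) = loc_proj s i x + loc_proj s i y"
  by (simp add: Finite_Cartesian_Product.vec_eq_iff loc_proj_nth)

lemma loc_proj_diff: "loc_proj s i (x - y) = loc_proj s i x - loc_proj s i y"
  by (simp add: Finite_Cartesian_Product.vec_eq_iff loc_proj_nth)

lemma loc_proj_scaleR: "loc_proj s i (c *\<^sub>R x) = c *\<^sub>R loc_proj s i x"
  by (simp add: Finite_Cartesian_Product.vec_eq_iff loc_proj_nth)

lemma loc_proj_zero [simp]: "loc_proj s i 0 = 0"
  by (simp add: Finite_Cartesian_Product.vec_eq_iff loc_proj_nth)

lemma loc_proj_sum: "loc_proj s i (sum f S) = (\<Sum>j\<in>S. loc_proj s i (f j))"
  by (simp add: Finite_Cartesian_Product.vec_eq_iff loc_proj_nth sum_component)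

lemma loc_proj_in_loc_space: "loc_proj s i x \<in> loc_space s i"
  by (simp add: loc_space_def loc_proj_nth)

lemma loc_proj_loc_space: "x \<in> loc_space s j \<Longrightarrow> loc_proj s i x = (if i = j then x else 0)"
  by (auto simp: loc_space_def Finite_Cartesian_Product.vec_eq_iff loc_proj_nth)

lemma sum_loc_proj: "(\<Sum>i\<in>UNIV. loc_proj (s::'c::finite \<Rightarrow> 'm::finite) i x) = x"
  by (simp add: Finite_Cartesian_Product.vec_eq_iff loc_proj_nth sum_component)

lemma loc_space_scaleR: "x \<in> loc_space s i \<Longrightarrow> c *\<^sub>R x \<in> loc_space s i"
  by (simp add: loc_space_def)

lemma blk_mult_vec_loc_space: "blk sr sc i j M *v x \<in> loc_space sr i"
  by (simp add: loc_space_def blk_def matrix_vector_mult_def)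

lemma loc_proj_matrix_vector_mult:
  fixes M :: "real^'c^'r" and sr :: "'r \<Rightarrow> 'm::finite" and sc :: "'c \<Rightarrow> 'm"
  assumes "\<And>r c. sr r = i \<Longrightarrow> M $ r $ c \<noteq> 0 \<Longrightarrow> sc c \<in> T"
  shows "loc_proj sr i (M *v x) = (\<Sum>j\<in>T. blk sr sc i j M *v loc_proj sc j x)"
proof -
  have "loc_proj sr i (M *v x) $ r = (\<Sum>j\<in>T. blk sr sc i j M *v loc_proj sc j x) $ r" for r
  proof (cases "sr r = i")
    case True
    have "(\<Sum>j\<in>T. blk sr sc i j M *v loc_proj sc j x) $ r
        = (\<Sum>j\<in>T. \<Sum>c\<in>UNIV. if sc c = j then M $ r $ c * x $ c else 0)"
      using True by (simp add: sum_component matrix_vector_mult_def blk_def loc_proj_nth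
          if_distrib cong: if_cong)
    also have "\<dots> = (\<Sum>c\<in>UNIV. if sc c \<in> T then M $ r $ c * x $ c else 0)"
      by (subst sum.swap) (simp add: sum.delta)
    also have "\<dots> = (\<Sum>c\<in>UNIV. M $ r $ c * x $ c)"
      using assms True by (intro sum.cong) auto
    finally show ?thesis using True by (simp add: loc_proj_nth matrix_vector_mult_def)
  qed (simp add: sum_component matrix_vector_mult_def blk_def loc_proj_nth)
  thus ?thesis by (simp add: Finite_Cartesian_Product.vec_eq_iff)
qed

lemma ex_pos_if_eventually_at_right_0:
  "(\<forall>\<^sub>F t in at_right (0::real). P t) \<Longrightarrow> \<exists>t>0. P t"
  unfolding eventually_at_right_field by (meson field_lbound_gt_zero)

lemma bounded_local_C_set: "local_C_set s i S \<Longrightarrow> bounded S"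
  unfolding local_C_set_def by (blast intro: compact_imp_bounded)

lemma local_C_set_eventually_scaled_subset:
  assumes S: "local_C_set s i S" and T: "bounded T" "T \<subseteq> loc_space s i"
  shows "\<forall>\<^sub>F t in at_right 0. \<forall>z\<in>T. t *\<^sub>R z \<in> S"
proof -
  obtain e where e: "0 < e" "cball 0 e \<inter> loc_space s i \<subseteq> S"
    using S unfolding local_C_set_def by blast
  obtain R where R: "0 < R" "\<And>z. z \<in> T \<Longrightarrow> norm z \<le> R"
    using T(1) unfolding bounded_pos by blast
  have "\<forall>z\<in>T. t *\<^sub>R z \<in> S" if t: "0 < t" "t < e / R" for t
  proof
    fix z assume z: "z \<in> T"
    have "t * norm z \<le> e / R * R"
      using t R z by (intro mult_mono) auto
    hence "norm (t *\<^sub>R z) \<le> e" using t R(1) by simp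
    moreover have "t *\<^sub>R z \<in> loc_space s i" using T(2) z by (intro loc_space_scaleR) auto
    ultimately show "t *\<^sub>R z \<in> S" using e(2) by auto
  qed
  moreover have "0 < e / R" using e R by simp
  ultimately show ?thesis unfolding eventually_at_right_field by blast
qed

lemma local_C_set_eventually_powers_inside:
  fixes M :: "real^'n::finite^'n"
  assumes M: "schur M" "\<And>y. M *v y \<in> loc_space s i" and S: "local_C_set s i S"
  shows "\<forall>\<^sub>F n in sequentially. \<forall>z\<in>S. c *\<^sub>R (((*v) M) ^^ n) z \<in> S"
proof -
  obtain r C where r: "0 < r" "r < 1"
    and decay: "\<And>k y. norm ((((*v) M) ^^ k) y) \<le> C * r ^ k * norm y"
    using schur_powers_decay[OF M(1)] by blast
  obtain e where e: "0 < e" "cball 0 e \<inter> loc_space s i \<subseteq> S"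
    using S unfolding local_C_set_def by blast
  have Sloc: "S \<subseteq> loc_space s i" using S unfolding local_C_set_def by blast
  obtain R where R: "\<And>z. z \<in> S \<Longrightarrow> norm z \<le> R"
    using bounded_local_C_set[OF S] unfolding bounded_iff by blast
  have "(\<lambda>n. \<bar>c\<bar> * \<bar>C\<bar> * \<bar>R\<bar> * r ^ n) \<longlonglongrightarrow> 0"
    using r by (intro tendsto_mult_right_zero LIMSEQ_power_zero) simp
  hence "\<forall>\<^sub>F n in sequentially. \<bar>c\<bar> * \<bar>C\<bar> * \<bar>R\<bar> * r ^ n < e"
    using e(1) by (rule order_tendstoD)
  thus ?thesis
  proof (rule eventually_mono, intro ballI)
    fix n z assume n: "\<bar>c\<bar> * \<bar>C\<bar> * \<bar>R\<bar> * r ^ n < e" and z: "z \<in> S"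
    have "norm ((((*v) M) ^^ n) z) \<le> C * r ^ n * norm z" by (rule decay)
    also have "\<dots> \<le> \<bar>C\<bar> * r ^ n * \<bar>R\<bar>"
      using R[OF z] r(1) by (intro mult_mono) auto
    finally have "norm ((((*v) M) ^^ n) z) \<le> \<bar>C\<bar> * \<bar>R\<bar> * r ^ n"
      by (simp only: mult_ac)
    hence "norm (c *\<^sub>R (((*v) M) ^^ n) z) \<le> \<bar>c\<bar> * (\<bar>C\<bar> * \<bar>R\<bar> * r ^ n)"
      by (simp add: mult_left_mono)
    hence "norm (c *\<^sub>R (((*v) M) ^^ n) z) \<le> e"
      using n by (simp add: mult.assoc)
    moreover have "(((*v) M) ^^ n) z \<in> loc_space s i"
      using M(2) Sloc z by (cases n) auto
    ultimately show "c *\<^sub>R (((*v) M) ^^ n) z \<in> S"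
      using e(2) loc_space_scaleR[of _ s i c] by (simp add: subset_iff)
  qed
qed

definition block_prod :: "('c \<Rightarrow> 'm) \<Rightarrow> ('m \<Rightarrow> (real^'c) set) \<Rightarrow> (real^'c) set" where
  "block_prod s Z = {x. \<forall>i. loc_proj s i x \<in> Z i}"

lemma zero_in_local_C_set: "local_C_set s i S \<Longrightarrow> 0 \<in> S"
  unfolding local_C_set_def loc_space_def by auto

lemma convex_block_prod: "(\<And>i. convex (Z i)) \<Longrightarrow> convex (block_prod s Z)"
  by (simp add: convex_def block_prod_def loc_proj_add loc_proj_scaleR)

lemma zero_in_block_prod: "(\<And>i. 0 \<in> Z i) \<Longrightarrow> 0 \<in> block_prod s Z"
  by (simp add: block_prod_def)

lemma bounded_block_prod:
  fixes s :: "'c::finite \<Rightarrow> 'm::finite"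
  assumes "\<And>i. bounded (Z i)"
  shows "bounded (block_prod s Z)"
proof -
  obtain R where R: "\<And>i z. z \<in> Z i \<Longrightarrow> norm z \<le> R i"
    using assms unfolding bounded_iff by metis
  have "norm x \<le> (\<Sum>i\<in>UNIV. R i)" if "x \<in> block_prod s Z" for x
  proof -
    have "norm x \<le> (\<Sum>i\<in>UNIV. norm (loc_proj s i x))"
      by (subst sum_loc_proj[symmetric]) (rule norm_sum)
    also have "\<dots> \<le> (\<Sum>i\<in>UNIV. R i)"
      using that R by (intro sum_mono) (auto simp: block_prod_def)
    finally show ?thesis .
  qed
  thus ?thesis unfolding bounded_iff by blast
qed

lemma block_prod_absorbing:
  fixes s :: "'c::finite \<Rightarrow> 'm::finite"
  assumes "\<And>i. local_C_set s i (Z i)"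
  shows "\<exists>t>0. t *\<^sub>R x \<in> block_prod s Z"
proof -
  have "\<forall>\<^sub>F t in at_right 0. \<forall>z\<in>{loc_proj s i x}. t *\<^sub>R z \<in> Z i" for i
    using assms loc_proj_in_loc_space by (intro local_C_set_eventually_scaled_subset) auto
  hence "\<forall>\<^sub>F t in at_right 0. \<forall>i. t *\<^sub>R loc_proj s i x \<in> Z i"
    by (intro eventually_all_finite) simp
  thus ?thesis
    by (auto dest!: ex_pos_if_eventually_at_right_0 simp: block_prod_def loc_proj_scaleR)
qed

section \<open>The closed loop of the network\<close>

locale tube_network =
  fixes A :: "real^'n^'n" and B :: "real^'p^'n" and K :: "real^'n^'p"
    and sx :: "'n \<Rightarrow> 'm::finite" and su :: "'p \<Rightarrow> 'm"
    and N :: "'m \<Rightarrow> 'm set"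
    and X Z Xh :: "'m \<Rightarrow> (real^'n) set" and U Uh :: "'m \<Rightarrow> (real^'p) set"
  assumes nbr: "\<forall>i. i \<notin> N i"
    and A_struct: "\<forall>r c. A $ r $ c \<noteq> 0 \<longrightarrow> sx c \<in> N (sx r) \<union> {sx r}"
    and B_struct: "\<forall>r c. B $ r $ c \<noteq> 0 \<longrightarrow> su c \<in> N (sx r) \<union> {sx r}"
    and K_diag: "\<forall>r c. K $ r $ c \<noteq> 0 \<longrightarrow> su r = sx c"
    and X_set: "\<forall>i. local_C_set sx i (X i)"
    and U_set: "\<forall>i. local_C_set su i (U i)"
    and F_schur: "\<forall>i. schur (blk sx sx i i A + blk sx su i i B ** blk su sx i i K)"
    and Z_set: "\<forall>i. local_C_set sx i (Z i)"
    and Z_inv: "\<forall>i. msum ((\<lambda>x. (blk sx sx i i A + blk sx su i i B ** blk su sx i i K) *v x) ` Z i)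
                        (wset A B sx su N X U i) \<subseteq> Z i"
    and Xh_set: "\<forall>i. local_C_set sx i (Xh i)"
    and Uh_set: "\<forall>i. local_C_set su i (Uh i)"
    and Xh_sub: "\<forall>i. Xh i \<subseteq> pdiff (X i) (Z i)"
    and Uh_sub: "\<forall>i. Uh i \<subseteq> pdiff (U i) ((\<lambda>x. blk su sx i i K *v x) ` Z i)"
begin

definition F_block :: "'m \<Rightarrow> real^'n^'n" where
  "F_block i = blk sx sx i i A + blk sx su i i B ** blk su sx i i K"

definition decoupled :: "real^'n \<Rightarrow> real^'n" where
  "decoupled x = (\<Sum>i\<in>UNIV. F_block i *v loc_proj sx i x)"

definition coupling :: "real^'n \<Rightarrow> real^'n" where
  "coupling x = (A + B ** K) *v x - decoupled x"

lemma F_block_mult_vec: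
  "F_block i *v y = blk sx sx i i A *v y + blk sx su i i B *v (blk su sx i i K *v y)"
  by (simp add: F_block_def matrix_vector_mult_add_rdistrib matrix_vector_mul_assoc)

lemma F_block_mult_vec_loc_space: "F_block i *v y \<in> loc_space sx i"
  using blk_mult_vec_loc_space[of sx sx i i A y] blk_mult_vec_loc_space[of sx su i i B]
  by (simp add: F_block_mult_vec loc_space_def)

lemma loc_proj_decoupled: "loc_proj sx i (decoupled x) = F_block i *v loc_proj sx i x"
  by (simp add: decoupled_def loc_proj_sum loc_proj_loc_space[OF F_block_mult_vec_loc_space])

lemma loc_proj_funpow_decoupled:
  "loc_proj sx i ((decoupled ^^ n) x) = (((*v) (F_block i)) ^^ n) (loc_proj sx i x)"
  by (induction n) (simp_all add: loc_proj_decoupled)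

lemma linear_decoupled: "linear decoupled"
  by (rule linearI)
    (simp_all add: decoupled_def loc_proj_add loc_proj_scaleR matrix_vector_right_distrib
      matrix_vector_mult_scaleR sum.distrib scaleR_sum_right)

lemma loc_proj_coupling:
  "loc_proj sx i (coupling x) = (\<Sum>j\<in>N i. blk sx sx i j A *v loc_proj sx j x
      + blk sx su i j B *v (blk su sx j j K *v loc_proj sx j x))"
proof -
  have pA: "loc_proj sx i (A *v x) = (\<Sum>j\<in>insert i (N i). blk sx sx i j A *v loc_proj sx j x)"
    by (rule loc_proj_matrix_vector_mult) (use A_struct in auto)
  have pB: "loc_proj sx i (B *v u) = (\<Sum>j\<in>insert i (N i). blk sx su i j B *v loc_proj su j u)"
    for u by (rule loc_proj_matrix_vector_mult) (use B_struct in auto)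
  have pK: "loc_proj su j (K *v x) = blk su sx j j K *v loc_proj sx j x" for j
    using loc_proj_matrix_vector_mult[of su j K sx "{j}" x] K_diag by auto
  have "loc_proj sx i ((A + B ** K) *v x) = loc_proj sx i (A *v x) + loc_proj sx i (B *v (K *v x))"
    by (simp add: matrix_vector_mult_add_rdistrib matrix_vector_mul_assoc loc_proj_add)
  also have "\<dots> = F_block i *v loc_proj sx i x + (\<Sum>j\<in>N i. blk sx sx i j A *v loc_proj sx j x
      + blk sx su i j B *v (blk su sx j j K *v loc_proj sx j x))"
    unfolding pA pB pK F_block_mult_vec using nbr by (simp add: sum.distrib algebra_simps)
  finally show ?thesis by (simp add: coupling_def loc_proj_diff loc_proj_decoupled)
qed

lemma decoupled_add_scaled_coupling_in_block_prod:
  assumes c: "\<forall>j. \<forall>z\<in>Z j. c *\<^sub>R z \<in> X j \<and> c *\<^sub>R (blk su sx j j K *v z) \<in> U j"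
    and x: "x \<in> block_prod sx Z"
  shows "decoupled x + c *\<^sub>R coupling x \<in> block_prod sx Z"
  unfolding block_prod_def
proof (intro CollectI allI)
  fix i
  define xs where "xs j = c *\<^sub>R loc_proj sx j x" for j
  define us where "us j = c *\<^sub>R (blk su sx j j K *v loc_proj sx j x)" for j
  have "c *\<^sub>R loc_proj sx i (coupling x) \<in> wset A B sx su N X U i"
  proof -
    have "c *\<^sub>R loc_proj sx i (coupling x)
        = (\<Sum>j\<in>N i. blk sx sx i j A *v xs j + blk sx su i j B *v us j)"
      by (simp add: loc_proj_coupling xs_def us_def scaleR_sum_right scaleR_add_right
          matrix_vector_mult_scaleR)
    moreover have "\<forall>j\<in>N i. xs j \<in> X j \<and> us j \<in> U j"
      using c x unfolding block_prod_def xs_def us_def by blast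
    ultimately show ?thesis unfolding wset_def by blast
  qed
  moreover have "F_block i *v loc_proj sx i x \<in> (\<lambda>y. F_block i *v y) ` Z i"
    using x by (simp add: block_prod_def)
  ultimately have "F_block i *v loc_proj sx i x + c *\<^sub>R loc_proj sx i (coupling x) \<in> Z i"
    using Z_inv unfolding msum_def F_block_def by blast
  thus "loc_proj sx i (decoupled x + c *\<^sub>R coupling x) \<in> Z i"
    by (simp add: loc_proj_add loc_proj_scaleR loc_proj_decoupled)
qed

lemma decoupled_block_prod: "decoupled ` block_prod sx Z \<subseteq> block_prod sx Z"
proof -
  have "0 \<in> X j" "0 \<in> U j" for j
    using X_set U_set by (metis zero_in_local_C_set)+
  thus ?thesis
    using decoupled_add_scaled_coupling_in_block_prod[of 0] by (simp add: image_subset_iff)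
qed

lemma ex_constraint_margin:
  "\<exists>d>0. \<forall>j. \<forall>z\<in>Z j. (1 + d) *\<^sub>R z \<in> X j \<and> (1 + d) *\<^sub>R (blk su sx j j K *v z) \<in> U j"
proof -
  have "\<forall>\<^sub>F t in at_right 0. \<forall>z\<in>Z j. t *\<^sub>R z \<in> Xh j \<and> t *\<^sub>R (blk su sx j j K *v z) \<in> Uh j"
    for j
  proof -
    have Zj: "local_C_set sx j (Z j)" using Z_set by blast
    have Z: "bounded (Z j)" "Z j \<subseteq> loc_space sx j"
      using bounded_local_C_set[OF Zj] Zj by (auto simp: local_C_set_def)
    have "\<forall>\<^sub>F t in at_right 0. \<forall>z\<in>Z j. t *\<^sub>R z \<in> Xh j"
      using Xh_set Z by (intro local_C_set_eventually_scaled_subset) auto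
    moreover have "\<forall>\<^sub>F t in at_right 0. \<forall>z\<in>(\<lambda>z. blk su sx j j K *v z) ` Z j. t *\<^sub>R z \<in> Uh j"
      using Uh_set Z(1) blk_mult_vec_loc_space
      by (intro local_C_set_eventually_scaled_subset bounded_linear_image) auto
    ultimately show ?thesis by eventually_elim auto
  qed
  hence "\<forall>\<^sub>F t in at_right 0.
      \<forall>j. \<forall>z\<in>Z j. t *\<^sub>R z \<in> Xh j \<and> t *\<^sub>R (blk su sx j j K *v z) \<in> Uh j"
    by (rule eventually_all_finite)
  then obtain d where d: "0 < d"
    "\<And>j z. z \<in> Z j \<Longrightarrow> d *\<^sub>R z \<in> Xh j \<and> d *\<^sub>R (blk su sx j j K *v z) \<in> Uh j"
    by (blast dest: ex_pos_if_eventually_at_right_0)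
  have "(1 + d) *\<^sub>R z \<in> X j \<and> (1 + d) *\<^sub>R (blk su sx j j K *v z) \<in> U j" if "z \<in> Z j" for j z
    using d(2)[OF that] Xh_sub Uh_sub that unfolding pdiff_def
    by (fastforce simp: scaleR_add_left add.commute)
  with d(1) show ?thesis by blast
qed

lemma ex_decoupled_power_halving:
  "\<exists>n. \<forall>x\<in>block_prod sx Z. 2 *\<^sub>R (decoupled ^^ n) x \<in> block_prod sx Z"
proof -
  have "\<forall>\<^sub>F n in sequentially. \<forall>i. \<forall>z\<in>Z i. 2 *\<^sub>R (((*v) (F_block i)) ^^ n) z \<in> Z i"
    using F_schur Z_set F_block_mult_vec_loc_space
    by (intro eventually_all_finite local_C_set_eventually_powers_inside)
      (auto simp: F_block_def)
  then obtain n where "\<forall>i. \<forall>z\<in>Z i. 2 *\<^sub>R (((*v) (F_block i)) ^^ n) z \<in> Z i"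
    unfolding eventually_sequentially by blast
  thus ?thesis
    by (auto simp: block_prod_def loc_proj_scaleR loc_proj_funpow_decoupled)
qed

theorem closed_loop_schur: "schur (A + B ** K)"
proof -
  obtain d where d: "0 < d"
    "\<forall>j. \<forall>z\<in>Z j. (1 + d) *\<^sub>R z \<in> X j \<and> (1 + d) *\<^sub>R (blk su sx j j K *v z) \<in> U j"
    using ex_constraint_margin by blast
  let ?S = "block_prod sx Z"
  let ?G = "\<lambda>x. decoupled x + (1 + d) *\<^sub>R coupling x"
  have S_convex: "convex ?S" using Z_set by (simp add: convex_block_prod local_C_set_def)
  have S_zero: "0 \<in> ?S" using Z_set by (intro zero_in_block_prod zero_in_local_C_set) blast
  have S_bounded: "bounded ?S" using Z_set by (intro bounded_block_prod bounded_local_C_set) blast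
  have "decoupled ` ?S \<subseteq> ?S" by (rule decoupled_block_prod)
  moreover have "?G ` ?S \<subseteq> ?S"
    using decoupled_add_scaled_coupling_in_block_prod[OF d(2)] by (simp add: image_subset_iff)
  moreover have "(A + B ** K) *v x = (d / (1 + d)) *\<^sub>R decoupled x + (1 - d / (1 + d)) *\<^sub>R ?G x"
    for x using d(1)
    by (simp add: coupling_def field_simps scaleR_add_right)
      (simp flip: scaleR_add_left add_divide_distrib)
  moreover obtain n where "\<And>x. x \<in> ?S \<Longrightarrow> 2 *\<^sub>R (decoupled ^^ n) x \<in> ?S"
    using ex_decoupled_power_halving by blast
  ultimately obtain \<rho> where \<rho>: "0 \<le> \<rho>" "\<rho> < 1"
    "\<forall>x\<in>?S. \<exists>y\<in>?S. (((*v) (A + B ** K)) ^^ n) x = \<rho> *\<^sub>R y"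
    using funpow_contracts_if_convex_split[OF S_convex S_zero linear_decoupled,
        where G = ?G and a = "d / (1 + d)" and F = "(*v) (A + B ** K)" and N = n] d(1)
    by auto
  show ?thesis
    using schur_if_contracts_absorbing_set[OF S_bounded block_prod_absorbing \<rho>(1,2)] Z_set \<rho>(3)
    by blast
qed

end

theorem mainTheorem4:
  fixes A :: "real^'n^'n" and B :: "real^'p^'n" and K :: "real^'n^'p"
    and sx :: "'n \<Rightarrow> 'm::finite" and su :: "'p \<Rightarrow> 'm"
    and N :: "'m \<Rightarrow> 'm set"
    and X Z Xh :: "'m \<Rightarrow> (real^'n) set" and U Uh :: "'m \<Rightarrow> (real^'p) set"
  assumes nbr: "\<forall>i. i \<notin> N i"
    and A_struct: "\<forall>r c. A $ r $ c \<noteq> 0 \<longrightarrow> sx c \<in> N (sx r) \<union> {sx r}"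
    and B_struct: "\<forall>r c. B $ r $ c \<noteq> 0 \<longrightarrow> su c \<in> N (sx r) \<union> {sx r}"
    and K_diag: "\<forall>r c. K $ r $ c \<noteq> 0 \<longrightarrow> su r = sx c"
    and X_set: "\<forall>i. local_C_set sx i (X i)"
    and U_set: "\<forall>i. local_C_set su i (U i)"
    and F_schur: "\<forall>i. schur (blk sx sx i i A + blk sx su i i B ** blk su sx i i K)"
    and Z_set: "\<forall>i. local_C_set sx i (Z i)"
    and Z_inv: "\<forall>i. msum ((\<lambda>x. (blk sx sx i i A + blk sx su i i B ** blk su sx i i K) *v x) ` Z i)
                        (wset A B sx su N X U i) \<subseteq> Z i"
    and Xh_set: "\<forall>i. local_C_set sx i (Xh i)"
    and Uh_set: "\<forall>i. local_C_set su i (Uh i)"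
    and Xh_sub: "\<forall>i. Xh i \<subseteq> pdiff (X i) (Z i)"
    and Uh_sub: "\<forall>i. Uh i \<subseteq> pdiff (U i) ((\<lambda>x. blk su sx i i K *v x) ` Z i)"
  shows "schur (A + B ** K)"
proof -
  interpret tube_network A B K sx su N X Z Xh U Uh
    by unfold_locales (fact assms)+
  show ?thesis by (rule closed_loop_schur)
qed

end
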